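(* Let $d$ be a positive integer and let $P$ be a simple graph with $d+1$ vertices and minimum degree $d-2$ having at most $d-2$ vertices of degree exactly $d-2$. Let $A=\{v\in V(P):\deg(v)=d-2\}$ and $B=V(P)\setminus A$. If $P$ has three or more gadgets, then $P$ is a $d$-pod.
   Context: A missing edge of $P$ is a pair of distinct vertices of $P$ that are not adjacent in $P$ (an edge of the complement of $P$). A gadget of $P$ is either (1) a missing odd cycle in $A$, i.e. a cycle of odd length all of whose vertices lie in $A$ and all of whose edges are missing edges of $P$; or (2) a missing path of length 2 with end vertices in $B$ and middle vertex in $A$, i.e. vertices $b,a,b'$ with $b,b'\in B$ distinct, $a\in A$, and $ba$, $ab'$ missing edges of $P$. A graph $H$ is immersed in a multigraph $G$ if there is an injection $\phi:V(H)\to V(G)$ and an assignment to each edge $uv\in E(H)$ of a path in $G$ between $\phi(u)$ and $\phi(v)$ with paths of distinct edges pairwise edge-disjoint. A $d$-pod is a simple graph in which every vertex has degree at least $d-2$ and at most $d-2$ vertices have degree exactly $d-2$, and such that, letting $A$ be its set of vertices of degree exactly $d-2$, for every maximum matching on $A$ (i.e. $\lfloor |A|/2\rfloor$ pairwise disjoint pairs of vertices of $A$), the multigraph obtained by adding one new edge joining each chosen pair (parallel edges allowed) has no immersion of $K_d$. *)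

theory Defs
  imports Main
begin

text \<open>Bounds involving \<open>d - 2\<close> are written with \<open>+ 2\<close> on the other side,
  because subtraction on \<^typ>\<open>nat\<close> truncates (this matters for \<open>d = 1\<close>).\<close>

definition two_subsets :: "'a set \<Rightarrow> 'a set set" where
  "two_subsets S = {e. e \<subseteq> S \<and> card e = 2}"

record 'a sgraph =
  verts :: "'a set"
  edges :: "'a set set"

definition simple_graph :: "'a sgraph \<Rightarrow> bool" where
  "simple_graph P \<longleftrightarrow> finite (verts P) \<and> edges P \<subseteq> two_subsets (verts P)"

definition degree :: "'a sgraph \<Rightarrow> 'a \<Rightarrow> nat" where
  "degree P v = card {u \<in> verts P. {u, v} \<in> edges P}"

definition complete_graph :: "nat \<Rightarrow> nat sgraph" where
  "complete_graph n = \<lparr>verts = {..<n}, edges = two_subsets {..<n}\<rparr>"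

text \<open>Edges of a multigraph have their own identity, so that edge-disjointness distinguishes
  parallel edges.\<close>

record ('a, 'e) multigraph =
  mverts :: "'a set"
  medges :: "'e set"
  ends :: "'e \<Rightarrow> 'a set"

text \<open>A path is given by its sequence of distinct vertices together with the sequence of
  edges it traverses.\<close>

definition is_path :: "('a, 'e) multigraph \<Rightarrow> 'a list \<Rightarrow> 'e list \<Rightarrow> bool" where
  "is_path G vs es \<longleftrightarrow>
     length vs = Suc (length es) \<and> distinct vs \<and>
     set vs \<subseteq> mverts G \<and> set es \<subseteq> medges G \<and>
     (\<forall>i < length es. ends G (es ! i) = {vs ! i, vs ! Suc i})"

text \<open>As \<open>e = {u, v}\<close> is unordered, \<open>\<phi> ` e = {\<phi> u, \<phi> v}\<close> is the set of ends of
  the path assigned to \<open>e\<close>.\<close>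

definition immersed :: "'h sgraph \<Rightarrow> ('a, 'e) multigraph \<Rightarrow> bool" where
  "immersed H G \<longleftrightarrow>
     (\<exists>\<phi> vs es. inj_on \<phi> (verts H) \<and> \<phi> ` verts H \<subseteq> mverts G \<and>
        (\<forall>e \<in> edges H. is_path G (vs e) (es e) \<and> {hd (vs e), last (vs e)} = \<phi> ` e) \<and>
        (\<forall>e \<in> edges H. \<forall>f \<in> edges H. e \<noteq> f \<longrightarrow> set (es e) \<inter> set (es f) = {}))"

definition max_matching_on :: "'a set \<Rightarrow> 'a set set \<Rightarrow> bool" where
  "max_matching_on A M \<longleftrightarrow>
     M \<subseteq> two_subsets A \<and> (\<forall>e \<in> M. \<forall>f \<in> M. e \<noteq> f \<longrightarrow> e \<inter> f = {}) \<and>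
     card M = card A div 2"

text \<open>The old edges are tagged \<^const>\<open>Inl\<close> and the new ones \<^const>\<open>Inr\<close>: a pair in \<open>M\<close>
  that is already adjacent in \<open>P\<close> yields a parallel edge.\<close>

definition add_edges :: "'a sgraph \<Rightarrow> 'a set set \<Rightarrow> ('a, 'a set + 'a set) multigraph" where
  "add_edges P M =
     \<lparr>mverts = verts P, medges = Inl ` edges P \<union> Inr ` M, ends = case_sum id id\<rparr>"

definition low_verts :: "nat \<Rightarrow> 'a sgraph \<Rightarrow> 'a set" where
  "low_verts d P = {v \<in> verts P. degree P v + 2 = d}"

definition d_pod :: "nat \<Rightarrow> 'a sgraph \<Rightarrow> bool" where
  "d_pod d P \<longleftrightarrow>
     simple_graph P \<and> (\<forall>v \<in> verts P. d \<le> degree P v + 2) \<and>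
     card (low_verts d P) + 2 \<le> d \<and>
     (\<forall>M. max_matching_on (low_verts d P) M \<longrightarrow>
        \<not> immersed (complete_graph d) (add_edges P M))"

definition missing_edges :: "'a sgraph \<Rightarrow> 'a set set" where
  "missing_edges P = two_subsets (verts P) - edges P"

text \<open>A gadget is represented by its edge set. As a cycle or path of positive length is
  determined by its edges, gadgets are counted as subgraphs, regardless of the
  starting point and direction of a traversal.\<close>

definition cycle_edges :: "'a list \<Rightarrow> 'a set set" where
  "cycle_edges c = {{c ! i, c ! (Suc i mod length c)} | i. i < length c}"

definition missing_odd_cycles :: "'a sgraph \<Rightarrow> 'a set \<Rightarrow> 'a set set set" where
  "missing_odd_cycles P A =
     {cycle_edges c | c. 3 \<le> length c \<and> odd (length c) \<and> distinct c \<and> set c \<subseteq> A \<and>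
        cycle_edges c \<subseteq> missing_edges P}"

definition missing_BAB_paths :: "'a sgraph \<Rightarrow> 'a set \<Rightarrow> 'a set \<Rightarrow> 'a set set set" where
  "missing_BAB_paths P A B =
     {{{b, a}, {a, b'}} | b a b'. b \<in> B \<and> b' \<in> B \<and> b \<noteq> b' \<and> a \<in> A \<and>
        {b, a} \<in> missing_edges P \<and> {a, b'} \<in> missing_edges P}"

definition gadgets :: "'a sgraph \<Rightarrow> 'a set \<Rightarrow> 'a set \<Rightarrow> 'a set set set" where
  "gadgets P A B = missing_odd_cycles P A \<union> missing_BAB_paths P A B"

end

theory Submission
  imports Defs
begin

text \<open>The complement of \<open>P\<close> has degree 2 at every vertex of \<open>A\<close>. An immersion of \<open>K\<^sub>d\<close> omits exactly
  one vertex \<open>w\<close>. Every vertex of \<open>A\<close> has degree at most \<open>d - 1\<close> in the enlarged graph, so a branch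
  vertex in \<open>A\<close> must be matched, and each of its edges is used by a different path ending there.
  Hence an edge \<open>uv\<close> of the matching \<open>M\<close> with \<open>u, v \<noteq> w\<close> cannot be parallel to an edge of \<open>P\<close>: both
  copies would lie on the path between \<open>u\<close> and \<open>v\<close>. So, apart from \<open>w\<close> and its possible partner, \<open>A\<close>
  is perfectly matched by missing edges. The vertices of a gadget in \<open>A\<close> are odd in number and form
  a component of the missing graph on \<open>A\<close>, so every gadget contains \<open>w\<close> or its partner, which
  leaves room for at most two gadgets.\<close>

section \<open>Path ends, transversals and perfect matchings\<close>

text \<open>Distinct ends rule out the trivial path, so there is a first and a last edge, and one of
  these contains \<open>p\<close>.\<close>

lemma path_edge_at_end:
  assumes path: "is_path G vs es" and ends: "{hd vs, last vs} = {p, q}" and "p \<noteq> q"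
  shows "\<exists>x \<in> set es. p \<in> ends G x"
proof -
  have len: "length vs = Suc (length es)"
    and step: "\<And>i. i < length es \<Longrightarrow> ends G (es ! i) = {vs ! i, vs ! Suc i}"
    using path by (auto simp: is_path_def)
  have vs: "vs \<noteq> []" using len by auto
  have es: "es \<noteq> []"
  proof
    assume "es = []"
    then obtain z where "vs = [z]" using len by (cases vs) auto
    then show False using ends \<open>p \<noteq> q\<close> by auto
  qed
  have "p = hd vs \<or> p = last vs" using ends by (auto simp: doubleton_eq_iff)
  then show ?thesis
  proof
    assume "p = hd vs"
    then have "p \<in> ends G (es ! 0)" using step[of 0] es vs by (simp add: hd_conv_nth)
    then show ?thesis using es by (meson length_greater_0_conv nth_mem)
  next
    assume "p = last vs"
    then have "p = vs ! Suc (length es - 1)" using len es vs by (simp add: last_conv_nth)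
    then have "p \<in> ends G (es ! (length es - 1))" using step[of "length es - 1"] es by simp
    then show ?thesis using es by (meson diff_less length_greater_0_conv nth_mem zero_less_one)
  qed
qed

text \<open>Any choice from pairwise disjoint sets is injective. This counts twice: paths ending at
  a branch vertex against the edges there, and gadgets against the vertices of a hitting
  set.\<close>

lemma disjoint_family_transversal:
  assumes "finite E" and "\<And>k. k \<in> K \<Longrightarrow> X k \<inter> E \<noteq> {}"
    and "\<And>k l. k \<in> K \<Longrightarrow> l \<in> K \<Longrightarrow> k \<noteq> l \<Longrightarrow> X k \<inter> X l = {}"
  shows "\<exists>f. inj_on f K \<and> f ` K \<subseteq> E \<and> (\<forall>k \<in> K. f k \<in> X k)"
proof -
  have "\<forall>k. \<exists>x. k \<in> K \<longrightarrow> x \<in> X k \<inter> E" using assms(2) by blast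
  then obtain f where f: "\<And>k. k \<in> K \<Longrightarrow> f k \<in> X k \<inter> E" by metis
  have "inj_on f K" using f assms(3) by (fastforce intro!: inj_onI)
  then show ?thesis using f by blast
qed

text \<open>\<open>S\<close> is the disjoint union of those pairs of \<open>M\<close> that lie
  inside it; \<open>M\<close> may contain further pairs elsewhere.\<close>

lemma even_card_perfect_matching:
  assumes "finite S" and "\<And>s. s \<in> S \<Longrightarrow> \<exists>m \<in> M. s \<in> m \<and> m \<subseteq> S"
    and "\<And>m. m \<in> M \<Longrightarrow> card m = 2"
    and "\<And>m n. m \<in> M \<Longrightarrow> n \<in> M \<Longrightarrow> m \<noteq> n \<Longrightarrow> m \<inter> n = {}"
  shows "even (card S)"
proof -
  have S: "S = \<Union>{m \<in> M. m \<subseteq> S}" using assms(2) by blast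
  have "2 dvd card (\<Union>{m \<in> M. m \<subseteq> S})"
    by (rule dvd_partition) (use assms S in auto)
  then show ?thesis using S by simp
qed

section \<open>Degrees in the graph and in its complement\<close>

lemma pair_in_two_subsets: "{u, v} \<in> two_subsets S \<longleftrightarrow> u \<in> S \<and> v \<in> S \<and> u \<noteq> v"
  by (auto simp: two_subsets_def card_2_iff doubleton_eq_iff)

lemma card_incident_edges_le:
  assumes "simple_graph P"
  shows "card {e \<in> edges P. v \<in> e} \<le> degree P v"
proof -
  have "{e \<in> edges P. v \<in> e} \<subseteq> (\<lambda>u. {u, v}) ` {u \<in> verts P. {u, v} \<in> edges P}"
  proof
    fix e assume e: "e \<in> {e \<in> edges P. v \<in> e}"
    then have "e \<subseteq> verts P" "card e = 2"
      using assms by (auto simp: simple_graph_def two_subsets_def)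
    then obtain u where "e = {u, v}" "u \<in> verts P" using e by (auto simp: card_2_iff)
    then show "e \<in> (\<lambda>u. {u, v}) ` {u \<in> verts P. {u, v} \<in> edges P}" using e by auto
  qed
  moreover have "finite {u \<in> verts P. {u, v} \<in> edges P}"
    using assms by (simp add: simple_graph_def)
  ultimately show ?thesis unfolding degree_def by (meson surj_card_le)
qed

definition missing_nbrs :: "'a sgraph \<Rightarrow> 'a \<Rightarrow> 'a set" where
  "missing_nbrs P v = {u. {v, u} \<in> missing_edges P}"

lemma missing_nbrs_sym: "u \<in> missing_nbrs P v \<longleftrightarrow> v \<in> missing_nbrs P u"
  by (simp add: missing_nbrs_def insert_commute)

text \<open>The vertices other than \<open>v\<close> split into neighbours and missing neighbours.
  With \<open>d + 1\<close> vertices and degree \<open>d - 2\<close>, this leaves two missing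
  neighbours.\<close>

lemma card_missing_nbrs:
  assumes "simple_graph P" "v \<in> verts P"
  shows "Suc (card (missing_nbrs P v) + degree P v) = card (verts P)"
proof -
  let ?N = "{u \<in> verts P. {u, v} \<in> edges P}"
  have fin: "finite (verts P)" and sub: "edges P \<subseteq> two_subsets (verts P)"
    using assms by (auto simp: simple_graph_def)
  have N: "missing_nbrs P v = verts P - insert v ?N"
    using assms(2)
    by (auto simp: missing_nbrs_def missing_edges_def pair_in_two_subsets insert_commute)
  have "v \<notin> ?N" using sub by (auto simp: two_subsets_def)
  then have "card (insert v ?N) = Suc (degree P v)"
    using fin by (simp add: degree_def)
  moreover have "card (verts P) = card (insert v ?N) + card (missing_nbrs P v)"
    unfolding N using card_mono[of "verts P" "insert v ?N"] fin assms(2)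
    by (subst card_Diff_subset) auto
  ultimately show ?thesis by simp
qed

section \<open>Gadgets as odd components of the missing graph\<close>

text \<open>For \<open>S\<close> inside \<open>A\<close>, these are the unions of components of the
  missing graph induced on \<open>A\<close>.\<close>

definition missing_closed :: "'a sgraph \<Rightarrow> 'a set \<Rightarrow> 'a set \<Rightarrow> bool" where
  "missing_closed P A S \<longleftrightarrow> (\<forall>a \<in> S. missing_nbrs P a \<inter> A \<subseteq> S)"

text \<open>Comparison with every closed \<open>T\<close> expresses connectedness without walks, so
  \<open>S\<close> is a single component; oddness makes it nonempty. The last clause recovers
  \<open>g\<close> from \<open>S\<close> and also collects missing edges from \<open>S\<close> to
  vertices outside \<open>A\<close>, as the paths require.\<close>

definition gadget_component :: "'a sgraph \<Rightarrow> 'a set \<Rightarrow> 'a set set \<Rightarrow> 'a set \<Rightarrow> bool" where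
  "gadget_component P A g S \<longleftrightarrow> S \<subseteq> A \<and> odd (card S) \<and> missing_closed P A S \<and>
     (\<forall>T. missing_closed P A T \<longrightarrow> S \<inter> T \<noteq> {} \<longrightarrow> S \<subseteq> T) \<and>
     g = {e \<in> missing_edges P. e \<inter> S \<noteq> {}}"

text \<open>Two components that meet contain each other, and equal components determine equal
  gadgets.\<close>

lemma gadget_components_disjoint:
  assumes "gadget_component P A g S" "gadget_component P A h T" "g \<noteq> h"
  shows "S \<inter> T = {}"
proof (rule ccontr)
  assume "S \<inter> T \<noteq> {}"
  then have "S = T" using assms unfolding gadget_component_def by (metis Int_commute subset_antisym)
  then show False using assms by (simp add: gadget_component_def)
qed

lemma missing_edge_cases:
  assumes "e \<in> missing_edges P" "v \<in> e"
  obtains u where "e = {v, u}" "u \<in> missing_nbrs P v"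
proof -
  have "card e = 2" using assms by (simp add: missing_edges_def two_subsets_def)
  then obtain u where "e = {v, u}" using assms by (auto simp: card_2_iff)
  then show ?thesis using that assms by (simp add: missing_nbrs_def)
qed

lemma two_nbrs:
  assumes "finite N" "card N \<le> 2" "x \<in> N" "y \<in> N" "x \<noteq> y"
  shows "N = {x, y}"
proof -
  have "{x, y} = N" by (rule card_seteq) (use assms in auto)
  then show ?thesis by simp
qed

text \<open>The ends \<open>b\<close> and \<open>b'\<close> use up both missing neighbours of
  \<open>a\<close> and lie outside \<open>A\<close>, so \<open>a\<close> alone is a
  component.\<close>

lemma path_gadget_component:
  assumes nbrs: "\<And>a. a \<in> A \<Longrightarrow> finite (missing_nbrs P a) \<and> card (missing_nbrs P a) \<le> 2"
    and g: "g \<in> missing_BAB_paths P A B" and "A \<inter> B = {}"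
  shows "\<exists>S. gadget_component P A g S"
proof -
  obtain b a b' where *: "b \<in> B" "b' \<in> B" "b \<noteq> b'" "a \<in> A"
    "{b, a} \<in> missing_edges P" "{a, b'} \<in> missing_edges P" "g = {{b, a}, {a, b'}}"
    using g by (auto simp: missing_BAB_paths_def)
  have N: "missing_nbrs P a = {b, b'}"
  proof (rule two_nbrs)
    show "b \<in> missing_nbrs P a" "b' \<in> missing_nbrs P a"
      using *(5,6) by (simp_all add: missing_nbrs_def insert_commute)
  qed (use nbrs * in auto)
  have "g = {e \<in> missing_edges P. e \<inter> {a} \<noteq> {}}"
  proof
    show "g \<subseteq> {e \<in> missing_edges P. e \<inter> {a} \<noteq> {}}" using * by auto
    show "{e \<in> missing_edges P. e \<inter> {a} \<noteq> {}} \<subseteq> g"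
      using N * by (auto elim!: missing_edge_cases)
  qed
  moreover have "missing_closed P A {a}"
    using N * \<open>A \<inter> B = {}\<close> by (auto simp: missing_closed_def)
  ultimately have "gadget_component P A g {a}"
    using * by (auto simp: gadget_component_def)
  then show ?thesis by blast
qed

text \<open>The two neighbours along the cycle use up the missing neighbours of each of its
  vertices, so no missing edge leaves the cycle and none is a chord.\<close>

lemma cycle_gadget_component:
  assumes nbrs: "\<And>a. a \<in> A \<Longrightarrow> finite (missing_nbrs P a) \<and> card (missing_nbrs P a) \<le> 2"
    and g: "g \<in> missing_odd_cycles P A"
  shows "\<exists>S. gadget_component P A g S"
proof -
  obtain c where c: "g = cycle_edges c" "3 \<le> length c" "odd (length c)" "distinct c"
    "set c \<subseteq> A" "cycle_edges c \<subseteq> missing_edges P"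
    using g by (auto simp: missing_odd_cycles_def)
  let ?n = "length c"
  have next_nbr: "c ! (Suc i mod ?n) \<in> missing_nbrs P (c ! i)" if "i < ?n" for i
    using c that by (auto simp: missing_nbrs_def cycle_edges_def)
  \<comment> \<open>The predecessor index is written with \<open>+ ?n\<close> so that the
    subtraction does not truncate at \<open>i = 0\<close>.\<close>
  have N: "missing_nbrs P (c ! i) = {c ! (Suc i mod ?n), c ! ((i + ?n - 1) mod ?n)}"
    if i: "i < ?n" for i
  proof (rule two_nbrs)
    have "c ! i \<in> A" using c(5) i by (meson nth_mem subsetD)
    then show "finite (missing_nbrs P (c ! i))" "card (missing_nbrs P (c ! i)) \<le> 2"
      using nbrs by blast+
    let ?p = "(i + ?n - 1) mod ?n"
    have p: "?p = (if i = 0 then ?n - 1 else i - 1)"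
    proof (cases "i = 0")
      case False
      then have "i + ?n - 1 = (i - 1) + ?n" by simp
      then have "?p = (i - 1) mod ?n" by (metis mod_add_self2)
      then show ?thesis using False i by simp
    qed (use c in simp)
    have s: "Suc i mod ?n = (if Suc i = ?n then 0 else Suc i)" using i by simp
    have "?p < ?n" using p i by auto
    moreover have sp: "Suc ?p mod ?n = i" using p i c(2) by auto
    ultimately have "c ! i \<in> missing_nbrs P (c ! ?p)" using next_nbr[of ?p] by simp
    then show "c ! ?p \<in> missing_nbrs P (c ! i)" using missing_nbrs_sym by metis
    \<comment> \<open>Successor and predecessor would coincide on a cycle of length 2; length at
      least 3 separates them.\<close>
    have "Suc i mod ?n \<noteq> ?p" using p s i c(2) by (auto split: if_splits)
    then show "c ! (Suc i mod ?n) \<noteq> c ! ?p"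
      using c(4) \<open>?p < ?n\<close> i s by (subst nth_eq_iff_index_eq) auto
  qed (use i next_nbr in auto)
  have n0: "0 < ?n" using c(2) by linarith
  have closed: "missing_closed P A (set c)"
    unfolding missing_closed_def
  proof
    fix a assume "a \<in> set c"
    then obtain i where "i < ?n" "a = c ! i" by (auto simp: in_set_conv_nth)
    then show "missing_nbrs P a \<inter> A \<subseteq> set c" using N n0 by auto
  qed
  have conn: "set c \<subseteq> T" if T: "missing_closed P A T" "set c \<inter> T \<noteq> {}" for T
  proof -
    obtain i where i: "i < ?n" "c ! i \<in> T" using T(2) by (auto simp: in_set_conv_nth)
    have walk: "c ! ((i + k) mod ?n) \<in> T" for k
    proof (induction k)
      case 0
      then show ?case using i by simp
    next
      case (Suc k)
      have lt: "(i + k) mod ?n < ?n" using n0 by simp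
      have "c ! (Suc ((i + k) mod ?n) mod ?n) \<in> missing_nbrs P (c ! ((i + k) mod ?n)) \<inter> A"
        using next_nbr[OF lt] c(5) n0 by (meson IntI mod_less_divisor nth_mem subsetD)
      then show ?case using Suc T(1) by (auto simp: missing_closed_def mod_Suc_eq)
    qed
    \<comment> \<open>The walk only goes forward, so \<open>j\<close> is reached from
      \<open>i\<close> after \<open>j + ?n - i\<close> steps, a number that stays nonnegative when
      \<open>j < i\<close>.\<close>
    have "c ! j \<in> T" if "j < ?n" for j
      using walk[of "j + ?n - i"] i(1) that by simp
    then show ?thesis by (auto simp: in_set_conv_nth)
  qed
  have "g = {e \<in> missing_edges P. e \<inter> set c \<noteq> {}}"
  proof
    show "g \<subseteq> {e \<in> missing_edges P. e \<inter> set c \<noteq> {}}"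
      using c(1,6) by (auto simp: cycle_edges_def)
    show "{e \<in> missing_edges P. e \<inter> set c \<noteq> {}} \<subseteq> g"
    proof
      fix e assume "e \<in> {e \<in> missing_edges P. e \<inter> set c \<noteq> {}}"
      then obtain i where i: "i < ?n" "c ! i \<in> e" and e: "e \<in> missing_edges P"
        by (auto simp: in_set_conv_nth)
      obtain u where u: "e = {c ! i, u}" "u \<in> missing_nbrs P (c ! i)"
        using e i(2) by (rule missing_edge_cases)
      let ?p = "(i + ?n - 1) mod ?n"
      have "Suc ?p mod ?n = i" using n0 i(1) by (simp add: mod_Suc_eq)
      moreover have "?p < ?n" using n0 by simp
      moreover have "u = c ! (Suc i mod ?n) \<or> u = c ! ?p" using u N i by auto
      ultimately have "e = {c ! i, c ! (Suc i mod ?n)} \<or> e = {c ! ?p, c ! (Suc ?p mod ?n)}"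
        using u(1) by (auto simp: insert_commute)
      then show "e \<in> g"
        unfolding c(1) cycle_edges_def using i(1) \<open>?p < ?n\<close> by blast
    qed
  qed
  then have "gadget_component P A g (set c)"
    using c closed conn by (simp add: gadget_component_def distinct_card)
  then show ?thesis by blast
qed

text \<open>The components of distinct gadgets are disjoint and each meets \<open>U\<close>, so
  choosing a common element maps the gadgets injectively into \<open>U\<close>.\<close>

lemma card_gadgets_le:
  assumes nbrs: "\<And>a. a \<in> A \<Longrightarrow> finite (missing_nbrs P a) \<and> card (missing_nbrs P a) \<le> 2"
    and "A \<inter> B = {}" and "finite U"
    and hit: "\<And>S. S \<subseteq> A \<Longrightarrow> odd (card S) \<Longrightarrow> missing_closed P A S \<Longrightarrow> S \<inter> U \<noteq> {}"
  shows "card (gadgets P A B) \<le> card U"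
proof -
  have "\<forall>g. \<exists>S. g \<in> gadgets P A B \<longrightarrow> gadget_component P A g S"
    using path_gadget_component[OF nbrs] cycle_gadget_component[OF nbrs] \<open>A \<inter> B = {}\<close>
    unfolding gadgets_def by blast
  then obtain S where S: "\<And>g. g \<in> gadgets P A B \<Longrightarrow> gadget_component P A g (S g)" by metis
  have "\<exists>f. inj_on f (gadgets P A B) \<and> f ` gadgets P A B \<subseteq> U \<and> (\<forall>g \<in> gadgets P A B. f g \<in> S g)"
  proof (rule disjoint_family_transversal[OF \<open>finite U\<close>])
    show "S g \<inter> U \<noteq> {}" if "g \<in> gadgets P A B" for g
      using S[OF that] hit by (simp add: gadget_component_def)
    show "S g \<inter> S h = {}" if "g \<in> gadgets P A B" "h \<in> gadgets P A B" "g \<noteq> h" for g h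
      using gadget_components_disjoint S that by blast
  qed
  then show ?thesis using \<open>finite U\<close> card_inj_on_le by blast
qed

section \<open>Immersions of complete graphs\<close>

definition incident :: "('a, 'e) multigraph \<Rightarrow> 'a \<Rightarrow> 'e set" where
  "incident G v = {x \<in> medges G. v \<in> ends G x}"

lemma incident_add_edges:
  "incident (add_edges P M) v = Inl ` {e \<in> edges P. v \<in> e} \<union> Inr ` {m \<in> M. v \<in> m}"
  by (auto simp: incident_def add_edges_def)

text \<open>Here \<open>X e\<close> is the edge set of the path for \<open>e\<close>. The
  \<open>d - 1\<close> paths ending at \<open>\<phi> i\<close> each need their own edge there. If
  there are fewer than \<open>d\<close> such edges, this assignment is a bijection: every edge at
  \<open>\<phi> i\<close> lies on one of these paths, and each path uses just one of them.\<close>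

lemma immersed_complete_graphE:
  assumes "immersed (complete_graph d) G" "finite (medges G)"
  obtains \<phi> X where "inj_on \<phi> {..<d}" "\<phi> ` {..<d} \<subseteq> mverts G"
    and "\<And>i. i < d \<Longrightarrow> d \<le> Suc (card (incident G (\<phi> i)))"
    and "\<And>i x. i < d \<Longrightarrow> card (incident G (\<phi> i)) < d \<Longrightarrow> x \<in> incident G (\<phi> i) \<Longrightarrow>
           \<exists>j < d. j \<noteq> i \<and> x \<in> X {i, j}"
    and "\<And>i j x y. i < d \<Longrightarrow> j < d \<Longrightarrow> i \<noteq> j \<Longrightarrow> card (incident G (\<phi> i)) < d \<Longrightarrow>
           x \<in> X {i, j} \<inter> incident G (\<phi> i) \<Longrightarrow> y \<in> X {i, j} \<inter> incident G (\<phi> i) \<Longrightarrow> x = y"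
    and "\<And>e f. e \<in> two_subsets {..<d} \<Longrightarrow> f \<in> two_subsets {..<d} \<Longrightarrow> e \<noteq> f \<Longrightarrow> X e \<inter> X f = {}"
proof -
  obtain \<phi> vs es where inj: "inj_on \<phi> {..<d}" and img: "\<phi> ` {..<d} \<subseteq> mverts G"
    and paths: "\<And>e. e \<in> two_subsets {..<d} \<Longrightarrow>
        is_path G (vs e) (es e) \<and> {hd (vs e), last (vs e)} = \<phi> ` e"
    and disj: "\<And>e f. e \<in> two_subsets {..<d} \<Longrightarrow> f \<in> two_subsets {..<d} \<Longrightarrow> e \<noteq> f \<Longrightarrow>
        set (es e) \<inter> set (es f) = {}"
    using assms(1) unfolding immersed_def complete_graph_def sgraph.simps by (elim exE conjE) metis
  have fin: "finite (incident G v)" for v using assms(2) by (simp add: incident_def)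
  have transversal: "\<exists>f. inj_on f ({..<d} - {i}) \<and> f ` ({..<d} - {i}) \<subseteq> incident G (\<phi> i) \<and>
      (\<forall>j \<in> {..<d} - {i}. f j \<in> set (es {i, j}))" if i: "i < d" for i
  proof (rule disjoint_family_transversal[OF fin])
    fix j assume j: "j \<in> {..<d} - {i}"
    then have e: "{i, j} \<in> two_subsets {..<d}" using i by (simp add: pair_in_two_subsets)
    have "\<phi> i \<noteq> \<phi> j" using inj i j by (auto simp: inj_on_def)
    moreover have "{hd (vs {i, j}), last (vs {i, j})} = {\<phi> i, \<phi> j}"
      using paths[OF e] by simp
    ultimately obtain x where "x \<in> set (es {i, j})" "\<phi> i \<in> ends G x"
      using path_edge_at_end paths[OF e] by metis
    moreover have "set (es {i, j}) \<subseteq> medges G" using paths[OF e] by (simp add: is_path_def)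
    ultimately show "set (es {i, j}) \<inter> incident G (\<phi> i) \<noteq> {}"
      by (auto simp: incident_def)
  next
    fix j k assume "j \<in> {..<d} - {i}" "k \<in> {..<d} - {i}" "j \<noteq> k"
    then show "set (es {i, j}) \<inter> set (es {i, k}) = {}"
      using disj[of "{i, j}" "{i, k}"] i by (simp add: pair_in_two_subsets doubleton_eq_iff)
  qed
  have deg: "d \<le> Suc (card (incident G (\<phi> i)))" if i: "i < d" for i
  proof -
    have "card ({..<d} - {i}) \<le> card (incident G (\<phi> i))"
      using transversal[OF i] fin card_inj_on_le by blast
    then show ?thesis using i by simp
  qed
  have onto: "\<exists>f. f ` ({..<d} - {i}) = incident G (\<phi> i) \<and>
      (\<forall>j \<in> {..<d} - {i}. f j \<in> set (es {i, j}))" if i: "i < d" "card (incident G (\<phi> i)) < d" for i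
  proof -
    obtain f where f: "inj_on f ({..<d} - {i})" "f ` ({..<d} - {i}) \<subseteq> incident G (\<phi> i)"
      "\<forall>j \<in> {..<d} - {i}. f j \<in> set (es {i, j})" using transversal[OF i(1)] by blast
    have "card (f ` ({..<d} - {i})) = d - 1" using f(1) i(1) by (simp add: card_image)
    then have "f ` ({..<d} - {i}) = incident G (\<phi> i)"
      using f(2) i(2) fin by (intro card_seteq) auto
    then show ?thesis using f by blast
  qed
  show ?thesis
  proof (rule that[OF inj img deg, of "\<lambda>e. set (es e)"])
    fix i x assume *: "i < d" "card (incident G (\<phi> i)) < d" "x \<in> incident G (\<phi> i)"
    obtain f where f: "f ` ({..<d} - {i}) = incident G (\<phi> i)"
      "\<forall>j \<in> {..<d} - {i}. f j \<in> set (es {i, j})" using onto * by blast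
    then obtain j where "j \<in> {..<d} - {i}" "x = f j" using *(3) by blast
    then show "\<exists>j < d. j \<noteq> i \<and> x \<in> set (es {i, j})" using f(2) by auto
  next
    fix i j x y assume *: "i < d" "j < d" "i \<noteq> j" "card (incident G (\<phi> i)) < d"
      "x \<in> set (es {i, j}) \<inter> incident G (\<phi> i)" "y \<in> set (es {i, j}) \<inter> incident G (\<phi> i)"
    obtain f where f: "f ` ({..<d} - {i}) = incident G (\<phi> i)"
      "\<forall>j \<in> {..<d} - {i}. f j \<in> set (es {i, j})" using onto * by blast
    \<comment> \<open>By surjectivity \<open>z = f k\<close> for some \<open>k\<close>, so
      \<open>z\<close> lies on the paths for both \<open>{i, k}\<close> and \<open>{i, j}\<close>;
      edge-disjointness forces \<open>k = j\<close>.\<close>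
    have "z = f j" if "z \<in> set (es {i, j}) \<inter> incident G (\<phi> i)" for z
    proof -
      obtain k where k: "k \<in> {..<d} - {i}" "z = f k" using f(1) \<open>z \<in> _\<close> by blast
      then have "z \<in> set (es {i, k})" using f(2) by blast
      then have "{i, k} = {i, j}"
        using disj[of "{i, k}" "{i, j}"] k * that by (auto simp: pair_in_two_subsets)
      then show ?thesis using k by (auto simp: doubleton_eq_iff)
    qed
    then show "x = y" using * by metis
  qed (use disj in auto)
qed

text \<open>The witness \<open>w\<close> is the single vertex of \<open>P\<close> outside the image
  of \<phi>; it may or may not lie in \<open>A\<close>.\<close>

lemma immersion_matching:
  assumes P: "simple_graph P" "card (verts P) = d + 1"
    and low: "\<And>a. a \<in> A \<Longrightarrow> a \<in> verts P \<and> degree P a + 2 = d"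
    and M: "M \<subseteq> two_subsets A" "\<And>m n. m \<in> M \<Longrightarrow> n \<in> M \<Longrightarrow> m \<noteq> n \<Longrightarrow> m \<inter> n = {}"
    and imm: "immersed (complete_graph d) (add_edges P M)"
  obtains w where "\<And>a. a \<in> A \<Longrightarrow> a \<noteq> w \<Longrightarrow> a \<in> \<Union>M"
    and "\<And>m. m \<in> M \<Longrightarrow> w \<notin> m \<Longrightarrow> m \<in> missing_edges P"
proof -
  let ?G = "add_edges P M"
  have fV: "finite (verts P)" and fE: "finite (edges P)" and fM: "finite M"
  proof -
    show V: "finite (verts P)" using P by (simp add: simple_graph_def)
    have "edges P \<subseteq> Pow (verts P)" using P by (auto simp: simple_graph_def two_subsets_def)
    then show "finite (edges P)" using V by (simp add: finite_subset)
    have "M \<subseteq> Pow (verts P)" using M(1) low by (auto simp: two_subsets_def)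
    then show "finite M" using V by (simp add: finite_subset)
  qed
  have inc: "card (incident ?G a) \<le> degree P a + card {m \<in> M. a \<in> m}" for a
    unfolding incident_add_edges using card_incident_edges_le[OF P(1), of a] fE fM
    by (subst card_Un_disjoint) (auto simp: card_image)
  have one: "card {m \<in> M. a \<in> m} \<le> 1" for a
    using fM M(2) by (auto simp: card_le_Suc0_iff_eq)
  \<comment> \<open>At most \<open>d - 2\<close> old edges and one matching edge: vertices of
    \<open>A\<close> are in the tight case of the preceding lemma.\<close>
  have full: "card (incident ?G a) < d" if "a \<in> A" for a
    using inc[of a] one[of a] low[OF that] by linarith
  have "finite (medges ?G)" using fE fM by (simp add: add_edges_def)
  from immersed_complete_graphE[OF imm this] obtain \<phi> X where inj: "inj_on \<phi> {..<d}"
    and img: "\<phi> ` {..<d} \<subseteq> mverts ?G"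
    and deg: "\<And>i. i < d \<Longrightarrow> d \<le> Suc (card (incident ?G (\<phi> i)))"
    and cover: "\<And>i x. i < d \<Longrightarrow> card (incident ?G (\<phi> i)) < d \<Longrightarrow> x \<in> incident ?G (\<phi> i) \<Longrightarrow>
           \<exists>j < d. j \<noteq> i \<and> x \<in> X {i, j}"
    and uniq: "\<And>i j x y. i < d \<Longrightarrow> j < d \<Longrightarrow> i \<noteq> j \<Longrightarrow> card (incident ?G (\<phi> i)) < d \<Longrightarrow>
           x \<in> X {i, j} \<inter> incident ?G (\<phi> i) \<Longrightarrow> y \<in> X {i, j} \<inter> incident ?G (\<phi> i) \<Longrightarrow> x = y"
    and disj: "\<And>e f. e \<in> two_subsets {..<d} \<Longrightarrow> f \<in> two_subsets {..<d} \<Longrightarrow> e \<noteq> f \<Longrightarrow> X e \<inter> X f = {}"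
    by blast
  have "card (\<phi> ` {..<d}) = d" using inj by (simp add: card_image)
  then have "card (verts P - \<phi> ` {..<d}) = 1"
    using img P(2) by (simp add: add_edges_def card_Diff_subset)
  then obtain w where w: "verts P - \<phi> ` {..<d} = {w}" by (auto simp: card_1_singleton_iff)
  have branch: "\<exists>i < d. a = \<phi> i" if "a \<in> A" "a \<noteq> w" for a
    using w low[OF that(1)] that(2) by blast
  show ?thesis
  proof (rule that)
    fix a assume a: "a \<in> A" "a \<noteq> w"
    show "a \<in> \<Union>M"
    proof (rule ccontr)
      \<comment> \<open>An unmatched \<open>a\<close> keeps at most \<open>d - 2\<close> edges, one
        too few for a branch vertex.\<close>
      assume "a \<notin> \<Union>M"
      then have "{m \<in> M. a \<in> m} = {}" by blast
      then have "card {m \<in> M. a \<in> m} = 0" by (simp only: card.empty)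
      then have "card (incident ?G a) + 2 \<le> d" using inc[of a] low[OF a(1)] by linarith
      then show False using branch[OF a] deg by fastforce
    qed
  next
    fix m assume m: "m \<in> M" "w \<notin> m"
    obtain u v where uv: "m = {u, v}" "u \<noteq> v" "u \<in> A" "v \<in> A"
      using M(1) m(1) by (auto simp: two_subsets_def card_2_iff)
    obtain i j where ij: "i < d" "u = \<phi> i" "j < d" "v = \<phi> j"
      using branch[of u] branch[of v] uv m by auto
    have "i \<noteq> j" using uv ij by auto
    \<comment> \<open>By tightness at both ends, an edge joining \<open>u\<close> and
      \<open>v\<close> lies on a path ending at \<open>u\<close> and on one ending at
      \<open>v\<close>. Edge-disjointness makes these the same path, the one between
      \<open>u\<close> and \<open>v\<close>.\<close>
    have on_path: "x \<in> X {i, j}" if x: "x \<in> incident ?G u \<inter> incident ?G v" for x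
    proof -
      obtain k where k: "k < d" "k \<noteq> i" "x \<in> X {i, k}"
        using cover[of i x] full[OF uv(3)] ij x by auto
      obtain l where l: "l < d" "l \<noteq> j" "x \<in> X {j, l}"
        using cover[of j x] full[OF uv(4)] ij x by auto
      have "{i, k} = {j, l}"
        using disj[of "{i, k}" "{j, l}"] k l ij by (auto simp: pair_in_two_subsets)
      then have "k = j" using \<open>i \<noteq> j\<close> by (auto simp: doubleton_eq_iff)
      then show ?thesis using k by simp
    qed
    have "m \<notin> edges P"
    proof
      assume "m \<in> edges P"
      then have l: "Inl m \<in> incident ?G u \<inter> incident ?G v"
        and r: "Inr m \<in> incident ?G u \<inter> incident ?G v"
        using uv m by (auto simp: incident_add_edges)
      \<comment> \<open>Both parallel copies would be edges at \<open>u\<close> on the path for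
        \<open>{i, j}\<close>, which has only one such edge.\<close>
      have "(Inl m :: 'a set + 'a set) = Inr m"
        by (rule uniq[of i j]) (use ij \<open>i \<noteq> j\<close> full[OF uv(3)] on_path[OF l] on_path[OF r] l r in auto)
      then show False by simp
    qed
    then show "m \<in> missing_edges P"
      using uv low by (simp add: missing_edges_def pair_in_two_subsets)
  qed
qed

section \<open>Bounding the number of gadgets\<close>

theorem theorem3p8:
  fixes d :: nat and P :: "'a sgraph" and A B :: "'a set"
  assumes "d > 0"
    and "simple_graph P"
    and "card (verts P) = d + 1"
    and "Min (degree P ` verts P) + 2 = d"
    and "A = low_verts d P"
    and "B = verts P - A"
    and "card A + 2 \<le> d"
    and "card (gadgets P A B) \<ge> 3"
  shows "d_pod d P"
proof -
  have fin: "finite (verts P)" using assms(2) by (simp add: simple_graph_def)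
  have low: "a \<in> verts P \<and> degree P a + 2 = d" if "a \<in> A" for a
    using that assms(5) by (simp add: low_verts_def)
  have finA: "finite A" using fin low by (meson finite_subset subsetI)
  have min_deg: "d \<le> degree P v + 2" if "v \<in> verts P" for v
  proof -
    have "Min (degree P ` verts P) \<le> degree P v" using fin that by simp
    then show ?thesis using assms(4) by linarith
  qed
  have nbrs: "finite (missing_nbrs P a) \<and> card (missing_nbrs P a) \<le> 2" if "a \<in> A" for a
  proof
    have "missing_nbrs P a \<subseteq> verts P"
      by (auto simp: missing_nbrs_def missing_edges_def pair_in_two_subsets)
    then show "finite (missing_nbrs P a)" using fin finite_subset by blast
    show "card (missing_nbrs P a) \<le> 2"
      using card_missing_nbrs[OF assms(2), of a] low[OF that] assms(3) by linarith
  qed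
  have "\<not> immersed (complete_graph d) (add_edges P M)" if max: "max_matching_on A M" for M
  proof
    assume imm: "immersed (complete_graph d) (add_edges P M)"
    have M: "M \<subseteq> two_subsets A" "\<And>m n. m \<in> M \<Longrightarrow> n \<in> M \<Longrightarrow> m \<noteq> n \<Longrightarrow> m \<inter> n = {}"
      using max by (auto simp: max_matching_on_def)
    obtain w where w: "\<And>a. a \<in> A \<Longrightarrow> a \<noteq> w \<Longrightarrow> a \<in> \<Union>M"
      "\<And>m. m \<in> M \<Longrightarrow> w \<notin> m \<Longrightarrow> m \<in> missing_edges P"
      using immersion_matching[OF assms(2,3) low M imm] by blast
    \<comment> \<open>\<open>U\<close> consists of \<open>w\<close> and, if \<open>w\<close> is
      matched, its partner.\<close>
    define U where "U = insert w (\<Union>{m \<in> M. w \<in> m})"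
    have U: "finite U \<and> card U \<le> 2"
    proof (cases "\<exists>m \<in> M. w \<in> m")
      case True
      then obtain m where m: "m \<in> M" "w \<in> m" by blast
      then have "{m \<in> M. w \<in> m} = {m}" using M(2) by blast
      then have "U = m" using m by (auto simp: U_def)
      moreover have "card m = 2" using M(1) m by (auto simp: two_subsets_def)
      ultimately show ?thesis by (simp add: card_ge_0_finite)
    next
      case False
      then have "U = {w}" by (auto simp: U_def)
      then show ?thesis by simp
    qed
    have "card (gadgets P A B) \<le> card U"
    proof (rule card_gadgets_le[OF nbrs])
      fix S assume S: "S \<subseteq> A" "odd (card S)" "missing_closed P A S"
      show "S \<inter> U \<noteq> {}"
      proof
        assume avoid: "S \<inter> U = {}"
        \<comment> \<open>Each \<open>s\<close> in \<open>S\<close> differs from \<open>w\<close>,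
          hence is matched, and its pair avoids \<open>w\<close> since \<open>s\<close> is not in
          \<open>U\<close>. The pair is therefore a missing edge, and closedness keeps the partner
          in \<open>S\<close>.\<close>
        have "even (card S)"
        proof (rule even_card_perfect_matching)
          show "finite S" using S(1) finA finite_subset by blast
          show "card m = 2" if "m \<in> M" for m using M(1) that by (auto simp: two_subsets_def)
          show "\<exists>m \<in> M. s \<in> m \<and> m \<subseteq> S" if s: "s \<in> S" for s
          proof -
            have "s \<in> \<Union>M" using w(1) s S(1) avoid by (auto simp: U_def)
            then obtain m where m: "m \<in> M" "s \<in> m" by blast
            then have "m \<in> missing_edges P" using w(2) s avoid by (auto simp: U_def)
            then obtain t where t: "m = {s, t}" "t \<in> missing_nbrs P s"
              using m(2) by (rule missing_edge_cases)
            have "t \<in> A" using M(1) m(1) t(1) by (auto simp: two_subsets_def)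
            then have "t \<in> S" using S(3) s t(2) by (auto simp: missing_closed_def)
            then show ?thesis using m(1) t(1) s by blast
          qed
        qed (use M(2) in blast)
        then show False using S(2) by simp
      qed
    qed (use assms(6) U in auto)
    then show False using U assms(8) by linarith
  qed
  then show ?thesis
    using assms(2,5,7) min_deg by (simp add: d_pod_def)
qed

end
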